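(* In the setting described in the context, let $(\hat Z_S,\hat Z_C)=E(Z)$ be a decomposition of the conditioning $Z$ by a deterministic measurable map $E:\mathbb{R}^d\to\mathbb{R}^d\times\mathbb{R}^d$ such that: (1) $\hat Z_S+\hat Z_C=Z$ almost surely; (2) almost surely, $Y=0\Longleftrightarrow \hat Z_S=0$; (3) $\hat Z_S$ and $\hat Z_C$ are independent. Let $\hat X = G(Z,\varepsilon)$ be the generated image, with latent factors $\hat S$ and $\hat C$. Then $$I(\hat S;\hat Z_S)\ \ge\ I(S;\hat S)\;-\;I(\hat X;\varepsilon\mid Z)\;-\;I(S;\hat Z_C\mid \hat Z_S)$$ and $$I(\hat C;\hat Z_C)\ \ge\ I(C;\hat C)\;-\;I(\hat X;\varepsilon\mid Z)\;-\;I(C;\hat Z_S\mid \hat Z_C).$$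
   Context: $I(\cdot\,;\cdot)$ and $I(\cdot\,;\cdot\mid\cdot)$ denote mutual information and conditional mutual information, with values in $[0,\infty]$; if infinite values occur, each inequality is read with the subtracted terms moved to the left-hand side. Real factors: $S$ (the salient factor) is a random vector with values in $\mathcal{S}\subset\mathbb{R}^{d_S}$ with $0\in\mathcal{S}$, $C$ (the common factor) is a random vector with values in $\mathcal{C}\subset\mathbb{R}^{d_C}$, and $S$ and $C$ are independent. The binary label is $Y\in\{0,1\}$ with $Y=0$ if and only if $S=0$, and $\mathbb{P}(Y=0)>0$. Images are $X=g(S,C)$, where $g:\mathcal{S}\times\mathcal{C}\to\mathcal{X}$ is deterministic and invertible (bimeasurable). Conditioning: $Z=f(X)\in\mathbb{R}^d$ for a deterministic map $f$, and it has the additive structure $Z=Z_S+Z_C$ with $Z_S=\varphi_S(S)\in V_S$, $Z_C=\varphi_C(C)\in V_C$, where $\varphi_S:\mathcal{S}\to V_S$ and $\varphi_C:\mathcal{C}\to V_C$ are measurable, $\varphi_S(0)=0$, and $V_S,V_C$ are linear subspaces with $\mathbb{R}^d=V_S\oplus V_C$. Generator: $\hat X=G(Z,\varepsilon)\in\mathcal{X}$, where $G$ is a deterministic measurable map and $\varepsilon\sim\mathcal{N}(0,I)$ is independent of $(S,C,Y)$ (hence of $Z$). The latent factors of the generated image are $(\hat S,\hat C):=g^{-1}(\hat X)\in\mathcal{S}\times\mathcal{C}$. *)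

theory Defs
  imports "HOL-Probability.Probability"
begin

text \<open>
  The library's \<open>KL_divergence b P Q\<close> is the real number \<open>D(Q || P)\<close> (reference measure first) and
  takes an unspecified or default value when the divergence is infinite. For probability measures
  \<open>Q << P\<close> the negative part of \<open>log b (dQ/dP)\<close> is always \<open>Q\<close>-integrable, so failure of
  integrability means \<open>D(Q || P) = \<infinity>\<close>. The argument order of the library is kept.
\<close>

definition ext_KL_divergence :: "real \<Rightarrow> 'a measure \<Rightarrow> 'a measure \<Rightarrow> ennreal" where
  "ext_KL_divergence b P Q =
     (if absolutely_continuous P Q \<and> integrable Q (entropy_density b P Q)
      then ennreal (KL_divergence b P Q) else \<infinity>)"

definition ext_mutual_information ::
    "real \<Rightarrow> 'a measure \<Rightarrow> 'x measure \<Rightarrow> 'y measure \<Rightarrow> ('a \<Rightarrow> 'x) \<Rightarrow> ('a \<Rightarrow> 'y) \<Rightarrow> ennreal" where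
  "ext_mutual_information b M MX MY X Y =
     ext_KL_divergence b (distr M MX X \<Otimes>\<^sub>M distr M MY Y) (distr M (MX \<Otimes>\<^sub>M MY) (\<lambda>\<omega>. (X \<omega>, Y \<omega>)))"

definition regular_cond_distr ::
    "'a measure \<Rightarrow> 'x measure \<Rightarrow> 'z measure \<Rightarrow> ('a \<Rightarrow> 'x) \<Rightarrow> ('a \<Rightarrow> 'z) \<Rightarrow> ('z \<Rightarrow> 'x measure) \<Rightarrow> bool" where
  "regular_cond_distr M MX MZ X Z K \<longleftrightarrow>
     K \<in> MZ \<rightarrow>\<^sub>M prob_algebra MX \<and>
     (\<forall>A\<in>sets MX. \<forall>B\<in>sets MZ.
        emeasure M {\<omega> \<in> space M. X \<omega> \<in> A \<and> Z \<omega> \<in> B} = (\<integral>\<^sup>+z\<in>B. emeasure (K z) A \<partial>distr M MZ Z))"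

text \<open>
  The measure \<open>P\<^sub>Z(dz) K(z, dx) L(z, dy)\<close>, with coordinates ordered \<open>(x, y, z)\<close>.
\<close>

definition cond_product ::
    "'x measure \<Rightarrow> 'y measure \<Rightarrow> 'z measure \<Rightarrow> 'z measure \<Rightarrow> ('z \<Rightarrow> 'x measure) \<Rightarrow> ('z \<Rightarrow> 'y measure)
       \<Rightarrow> ('x \<times> 'y \<times> 'z) measure" where
  "cond_product MX MY MZ PZ K L =
     PZ \<bind> (\<lambda>z. distr (K z \<Otimes>\<^sub>M L z) (MX \<Otimes>\<^sub>M MY \<Otimes>\<^sub>M MZ) (\<lambda>(x, y). (x, y, z)))"

text \<open>
  \<open>I(X; Y | Z)\<close> is the divergence of the law of \<open>(X, Y, Z)\<close> from \<open>P\<^sub>Z P\<^sub>X\<^sub>|\<^sub>Z P\<^sub>Y\<^sub>|\<^sub>Z\<close>. The infimum is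
  merely a way to select versions \<open>K\<close>, \<open>L\<close> of the regular conditional distributions: the value
  does not depend on them, see \<open>ext_cond_mutual_information_eq\<close> below. Versions exist whenever
  \<open>MX\<close> and \<open>MY\<close> are standard Borel.
\<close>

definition ext_cond_mutual_information ::
    "real \<Rightarrow> 'a measure \<Rightarrow> 'x measure \<Rightarrow> 'y measure \<Rightarrow> 'z measure
       \<Rightarrow> ('a \<Rightarrow> 'x) \<Rightarrow> ('a \<Rightarrow> 'y) \<Rightarrow> ('a \<Rightarrow> 'z) \<Rightarrow> ennreal" where
  "ext_cond_mutual_information b M MX MY MZ X Y Z =
     (INF (K, L) \<in> {(K, L). regular_cond_distr M MX MZ X Z K \<and> regular_cond_distr M MY MZ Y Z L}.
        ext_KL_divergence b
          (cond_product MX MY MZ (distr M MZ Z) K L)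
          (distr M (MX \<Otimes>\<^sub>M MY \<Otimes>\<^sub>M MZ) (\<lambda>\<omega>. (X \<omega>, Y \<omega>, Z \<omega>))))"

text \<open>
  The library's \<open>indep_var\<close> forces both variables to have the same type of values; the
  following is its heterogeneous form.
\<close>

definition indep_rv ::
    "'a measure \<Rightarrow> 'x measure \<Rightarrow> ('a \<Rightarrow> 'x) \<Rightarrow> 'y measure \<Rightarrow> ('a \<Rightarrow> 'y) \<Rightarrow> bool" where
  "indep_rv M MX X MY Y \<longleftrightarrow>
     X \<in> M \<rightarrow>\<^sub>M MX \<and> Y \<in> M \<rightarrow>\<^sub>M MY \<and>
     prob_space.indep_set M
       (sigma_sets (space M) {X -` A \<inter> space M | A. A \<in> sets MX})
       (sigma_sets (space M) {Y -` B \<inter> space M | B. B \<in> sets MY})"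

lemma indep_rv_iff_indep_var:
  assumes "prob_space M"
  shows "indep_rv M MX X MY Y \<longleftrightarrow> prob_space.indep_var M MX X MY Y"
  by (simp add: indep_rv_def prob_space.indep_var_eq[OF assms])

lemma ext_mutual_information_finite:
  assumes "prob_space M" "ext_mutual_information b M MX MY X Y \<noteq> \<infinity>"
  shows "ext_mutual_information b M MX MY X Y = ennreal (prob_space.mutual_information M b MX MY X Y)"
  using assms
  by (auto simp: ext_mutual_information_def ext_KL_divergence_def
        prob_space.mutual_information_def[OF assms(1)] split: if_splits)

lemma cond_product_kernel_measurable:
  assumes "K \<in> MZ \<rightarrow>\<^sub>M prob_algebra MX" "L \<in> MZ \<rightarrow>\<^sub>M prob_algebra MY"
  shows "(\<lambda>z. distr (K z \<Otimes>\<^sub>M L z) (MX \<Otimes>\<^sub>M MY \<Otimes>\<^sub>M MZ) (\<lambda>(x, y). (x, y, z)))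
           \<in> MZ \<rightarrow>\<^sub>M subprob_algebra (MX \<Otimes>\<^sub>M MY \<Otimes>\<^sub>M MZ)"
proof (rule measurable_distr2)
  show "(\<lambda>(z, x, y). (x, y, z)) \<in> MZ \<Otimes>\<^sub>M (MX \<Otimes>\<^sub>M MY) \<rightarrow>\<^sub>M MX \<Otimes>\<^sub>M MY \<Otimes>\<^sub>M MZ"
    by measurable
  show "(\<lambda>z. K z \<Otimes>\<^sub>M L z) \<in> MZ \<rightarrow>\<^sub>M subprob_algebra (MX \<Otimes>\<^sub>M MY)"
    using assms by (intro measurable_pair_measure measurable_prob_algebraD)
qed

lemma emeasure_cond_product_Times:
  assumes K: "K \<in> MZ \<rightarrow>\<^sub>M prob_algebra MX" and L: "L \<in> MZ \<rightarrow>\<^sub>M prob_algebra MY"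
    and PZ: "sets PZ = sets MZ" "space MZ \<noteq> {}"
    and A: "A \<in> sets MX" and B: "B \<in> sets MY" and C: "C \<in> sets MZ"
  shows "emeasure (cond_product MX MY MZ PZ K L) (A \<times> B \<times> C) =
           (\<integral>\<^sup>+z\<in>C. emeasure (K z) A * emeasure (L z) B \<partial>PZ)"
proof -
  have sp: "space PZ = space MZ"
    using PZ(1) by (rule sets_eq_imp_space_eq)
  have "emeasure (cond_product MX MY MZ PZ K L) (A \<times> B \<times> C) =
      (\<integral>\<^sup>+z. emeasure (distr (K z \<Otimes>\<^sub>M L z) (MX \<Otimes>\<^sub>M MY \<Otimes>\<^sub>M MZ) (\<lambda>(x, y). (x, y, z))) (A \<times> B \<times> C) \<partial>PZ)"
    unfolding cond_product_def
    using cond_product_kernel_measurable[OF K L] PZ(1)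
    by (intro emeasure_bind)
       (auto simp: sp PZ(2) A B C measurable_cong_sets[OF PZ(1) refl])
  also have "\<dots> = (\<integral>\<^sup>+z\<in>C. emeasure (K z) A * emeasure (L z) B \<partial>PZ)"
  proof (rule nn_integral_cong)
    fix z assume "z \<in> space PZ"
    then have z: "z \<in> space MZ" by (simp add: sp)
    have Kz: "sets (K z) = sets MX" "prob_space (K z)" and Lz: "sets (L z) = sets MY" "prob_space (L z)"
      using measurable_space[OF K z] measurable_space[OF L z] by (auto simp: space_prob_algebra)
    interpret Lz: prob_space "L z" by fact
    have [measurable_cong]: "sets (K z) = sets MX" "sets (L z) = sets MY" by fact+
    have "(\<lambda>(x, y). (x, y, z)) -` (A \<times> B \<times> C) \<inter> space (K z \<Otimes>\<^sub>M L z) = (if z \<in> C then A \<times> B else {})"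
      using sets.sets_into_space[OF A] sets.sets_into_space[OF B]
        sets_eq_imp_space_eq[OF Kz(1)] sets_eq_imp_space_eq[OF Lz(1)]
      by (auto simp: space_pair_measure)
    moreover have "(\<lambda>(x, y). (x, y, z)) \<in> K z \<Otimes>\<^sub>M L z \<rightarrow>\<^sub>M MX \<Otimes>\<^sub>M MY \<Otimes>\<^sub>M MZ"
      using z by measurable
    ultimately show "emeasure (distr (K z \<Otimes>\<^sub>M L z) (MX \<Otimes>\<^sub>M MY \<Otimes>\<^sub>M MZ) (\<lambda>(x, y). (x, y, z))) (A \<times> B \<times> C) =
        emeasure (K z) A * emeasure (L z) B * indicator C z"
      using A B C by (simp add: emeasure_distr Kz Lz Lz.emeasure_pair_measure_Times)
  qed
  finally show ?thesis .
qed

lemma regular_cond_distr_AE_unique: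
  assumes "prob_space M" and Z: "Z \<in> M \<rightarrow>\<^sub>M MZ"
    and K: "regular_cond_distr M MX MZ X Z K" and K': "regular_cond_distr M MX MZ X Z K'"
    and A: "A \<in> sets MX"
  shows "AE z in distr M MZ Z. emeasure (K z) A = emeasure (K' z) A"
proof -
  interpret prob_space M by fact
  interpret PZ: prob_space "distr M MZ Z" using Z by (rule prob_space_distr)
  have meas: "(\<lambda>z. emeasure (J z) A) \<in> borel_measurable (distr M MZ Z)"
    if "J \<in> MZ \<rightarrow>\<^sub>M prob_algebra MX" for J
    using measurable_compose[OF measurable_prob_algebraD[OF that]
        measurable_emeasure_subprob_algebra[OF A]] by simp
  have "density (distr M MZ Z) (\<lambda>z. emeasure (K z) A) = density (distr M MZ Z) (\<lambda>z. emeasure (K' z) A)"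
    using K K' A meas
    by (intro measure_eqI) (auto simp: regular_cond_distr_def emeasure_density)
  then show ?thesis
    using K K' by (intro iffD1[OF PZ.density_unique_iff] meas) (simp_all add: regular_cond_distr_def)
qed

lemma cond_product_unique:
  assumes M: "prob_space M" and Z: "Z \<in> M \<rightarrow>\<^sub>M MZ"
    and K: "regular_cond_distr M MX MZ X Z K" "regular_cond_distr M MX MZ X Z K'"
    and L: "regular_cond_distr M MY MZ Y Z L" "regular_cond_distr M MY MZ Y Z L'"
  shows "cond_product MX MY MZ (distr M MZ Z) K L = cond_product MX MY MZ (distr M MZ Z) K' L'"
    (is "?Q K L = ?Q K' L'")
proof -
  interpret prob_space M by fact
  interpret PZ: prob_space "distr M MZ Z" using Z by (rule prob_space_distr)
  let ?N = "MX \<Otimes>\<^sub>M MY \<Otimes>\<^sub>M MZ"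
  let ?E = "{A \<times> B \<times> C | A B C. A \<in> sets MX \<and> B \<in> sets MY \<and> C \<in> sets MZ}"
  have ne: "space MZ \<noteq> {}" using PZ.not_empty by simp
  have k: "K \<in> MZ \<rightarrow>\<^sub>M prob_algebra MX" "K' \<in> MZ \<rightarrow>\<^sub>M prob_algebra MX"
    "L \<in> MZ \<rightarrow>\<^sub>M prob_algebra MY" "L' \<in> MZ \<rightarrow>\<^sub>M prob_algebra MY"
    using K L by (auto simp: regular_cond_distr_def)
  have setsQ: "sets (?Q J H) = sets ?N"
    if "J \<in> MZ \<rightarrow>\<^sub>M prob_algebra MX" "H \<in> MZ \<rightarrow>\<^sub>M prob_algebra MY" for J H
    unfolding cond_product_def using ne by (intro sets_bind) auto
  have sN: "sets ?N = sigma_sets (space ?N) ?E"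
  proof -
    have "sets ?N = sets (sigma (space MX \<times> space (MY \<Otimes>\<^sub>M MZ))
        {a \<times> b | a b. a \<in> sets MX \<and> b \<in> {B \<times> C | B C. B \<in> sets MY \<and> C \<in> sets MZ}})"
      by (intro sets_pair_eq[where Ca="{space MX}" and Cb="{space (MY \<Otimes>\<^sub>M MZ)}"])
         (auto simp: sets.space_closed sets.sigma_sets_eq sets_pair_measure space_pair_measure
               dest: sets.sets_into_space)
    also have "{a \<times> b | a b. a \<in> sets MX \<and> b \<in> {B \<times> C | B C. B \<in> sets MY \<and> C \<in> sets MZ}} = ?E"
      by auto
    also have "sets (sigma (space MX \<times> space (MY \<Otimes>\<^sub>M MZ)) ?E) = sigma_sets (space ?N) ?E"
      by (subst sets_measure_of) (auto simp: space_pair_measure dest: sets.sets_into_space)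
    finally show ?thesis .
  qed
  show ?thesis
  proof (rule measure_eqI_generator_eq[where E="?E" and \<Omega>="space ?N" and A="\<lambda>_::nat. space ?N"])
    show "Int_stable ?E"
    proof (rule Int_stableI)
      fix a b assume "a \<in> ?E" "b \<in> ?E"
      then obtain A B C A' B' C' where "a = A \<times> B \<times> C" "b = A' \<times> B' \<times> C'"
        "A \<in> sets MX" "B \<in> sets MY" "C \<in> sets MZ" "A' \<in> sets MX" "B' \<in> sets MY" "C' \<in> sets MZ"
        by auto
      then show "a \<inter> b \<in> ?E"
        by (intro CollectI exI[of _ "A \<inter> A'"] exI[of _ "B \<inter> B'"] exI[of _ "C \<inter> C'"]) auto
    qed
    show "?E \<subseteq> Pow (space ?N)"
      by (auto simp: space_pair_measure dest: sets.sets_into_space)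
    show "sets (?Q K L) = sigma_sets (space ?N) ?E" "sets (?Q K' L') = sigma_sets (space ?N) ?E"
      using setsQ k sN by auto
    show "range (\<lambda>_::nat. space ?N) \<subseteq> ?E"
      by (auto simp: space_pair_measure)
    show "(\<Union>i::nat. space ?N) = space ?N" by simp
  next
    fix a assume "a \<in> ?E"
    then obtain A B C where a: "a = A \<times> B \<times> C" "A \<in> sets MX" "B \<in> sets MY" "C \<in> sets MZ"
      by auto
    have "AE z in distr M MZ Z. emeasure (K z) A = emeasure (K' z) A"
      "AE z in distr M MZ Z. emeasure (L z) B = emeasure (L' z) B"
      using regular_cond_distr_AE_unique[OF M Z] K L a by blast+
    then have "(\<integral>\<^sup>+z\<in>C. emeasure (K z) A * emeasure (L z) B \<partial>distr M MZ Z) =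
        (\<integral>\<^sup>+z\<in>C. emeasure (K' z) A * emeasure (L' z) B \<partial>distr M MZ Z)"
      by (intro nn_integral_cong_AE) auto
    then show "emeasure (?Q K L) a = emeasure (?Q K' L') a"
      using a k ne by (simp add: emeasure_cond_product_Times)
  next
    have "emeasure (K z) (space MX) = 1 \<and> emeasure (L z) (space MY) = 1" if "z \<in> space MZ" for z
      using measurable_space[OF k(1) that] measurable_space[OF k(3) that]
      unfolding space_prob_algebra
      by (metis (mono_tags, lifting) mem_Collect_eq prob_space.emeasure_space_1 sets_eq_imp_space_eq)
    then have "(\<integral>\<^sup>+z\<in>space MZ. emeasure (K z) (space MX) * emeasure (L z) (space MY) \<partial>distr M MZ Z) =
        (\<integral>\<^sup>+z. 1 \<partial>distr M MZ Z)"
      by (intro nn_integral_cong) auto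
    then show "emeasure (?Q K L) (space ?N) \<noteq> \<infinity>" for i :: nat
      using k ne PZ.emeasure_space_1 by (simp add: space_pair_measure emeasure_cond_product_Times)
  qed
qed

lemma ext_cond_mutual_information_eq:
  assumes M: "prob_space M" and Z: "Z \<in> M \<rightarrow>\<^sub>M MZ"
    and K: "regular_cond_distr M MX MZ X Z K" and L: "regular_cond_distr M MY MZ Y Z L"
  shows "ext_cond_mutual_information b M MX MY MZ X Y Z =
           ext_KL_divergence b
             (cond_product MX MY MZ (distr M MZ Z) K L)
             (distr M (MX \<Otimes>\<^sub>M MY \<Otimes>\<^sub>M MZ) (\<lambda>\<omega>. (X \<omega>, Y \<omega>, Z \<omega>)))"
proof -
  let ?KL = "{(K, L). regular_cond_distr M MX MZ X Z K \<and> regular_cond_distr M MY MZ Y Z L}"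
  let ?D = "\<lambda>(K, L). ext_KL_divergence b (cond_product MX MY MZ (distr M MZ Z) K L)
      (distr M (MX \<Otimes>\<^sub>M MY \<Otimes>\<^sub>M MZ) (\<lambda>\<omega>. (X \<omega>, Y \<omega>, Z \<omega>)))"
  have "?D p = ?D (K, L)" if "p \<in> ?KL" for p
    using that cond_product_unique[OF M Z _ K _ L, of "fst p" "snd p"] by (auto split: prod.splits)
  moreover have "(K, L) \<in> ?KL"
    using K L by simp
  ultimately have "(INF p\<in>?KL. ?D p) = ?D (K, L)"
    by (metis (no_types, lifting) INF_eq_const empty_iff)
  then show ?thesis
    unfolding ext_cond_mutual_information_def by simp
qed

end

theory Submission
  imports Defs
begin

text \<open>
  Since \<open>S \<rightarrow> Z \<rightarrow> Shat\<close> is a Markov chain and \<open>Z\<close> is almost surely a function of \<open>(ZhatS, ZhatC)\<close>,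
  the chain rule gives \<open>I(S; Shat) \<le> I(S, ZhatS; Shat) = I(ZhatS; Shat) + I(S; Shat | ZhatS)\<close>, and data
  processing gives \<open>I(S; Shat | ZhatS) \<le> I(S; ZhatC | ZhatS)\<close>. The term \<open>I(Xhat; eps | Z)\<close> is only
  used to be nonnegative, and the second inequality is the same with the roles exchanged.

  As the divergences may be infinite and the conditional laws of \<open>Shat\<close> are not at hand, both steps are
  carried out on reference measures. Under the reference measure of \<open>I(S; ZhatC | ZhatS)\<close>, with an
  independent copy of the noise, \<open>Shat\<close> and \<open>ZhatS\<close> keep their joint law while \<open>S\<close> becomes conditionally
  independent of \<open>Shat\<close> given \<open>ZhatS\<close>. The image of this measure under the generator therefore has
  density \<open>dP\<^bsub>(Shat, ZhatS)\<^esub> / d(P\<^bsub>Shat\<^esub> \<otimes> P\<^bsub>ZhatS\<^esub>)\<close> with respect to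
  \<open>P\<^bsub>Shat\<^esub> \<otimes> P\<^bsub>(S, ZhatS)\<^esub>\<close>, which makes the divergences add up.
\<close>

section \<open>Extended Kullback--Leibler divergence\<close>

text \<open>Uniqueness of the Radon-Nikodym derivative identifies \<open>RN_deriv\<close> with
  \<open>d\<close> almost everywhere. Absolute continuity is then automatic, and integrability of
  \<open>log b (d x)\<close> alone decides whether the value is finite.\<close>

lemma ext_KL_divergence_density:
  assumes "prob_space Q" and d [measurable]: "d \<in> borel_measurable Q" and nn: "\<And>x. 0 \<le> d x"
  shows "ext_KL_divergence b Q (density Q d) =
    (if integrable (density Q d) (\<lambda>x. log b (d x))
     then ennreal (\<integral>x. log b (d x) \<partial>density Q d) else \<infinity>)"
proof -
  interpret prob_space Q by fact
  let ?P = "density Q d"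
  have ac: "absolutely_continuous Q ?P"
    by (rule absolutely_continuousI_density) simp
  have "AE x in Q. RN_deriv Q ?P x = ennreal (d x)"
    by (rule AE_symmetric, rule RN_deriv_unique[OF _ refl]) measurable
  then have "AE x in Q. 0 < ennreal (d x) \<longrightarrow> entropy_density b Q ?P x = log b (d x)"
    using nn by (auto simp: entropy_density_def)
  then have ae: "AE x in ?P. entropy_density b Q ?P x = log b (d x)"
    by (simp add: AE_density)
  have meas: "entropy_density b Q ?P \<in> borel_measurable ?P"
    unfolding entropy_density_def by simp
  have "integrable ?P (entropy_density b Q ?P) \<longleftrightarrow> integrable ?P (\<lambda>x. log b (d x))"
    by (intro integrable_cong_AE meas ae) measurable
  moreover have "(\<integral>x. entropy_density b Q ?P x \<partial>?P) = (\<integral>x. log b (d x) \<partial>?P)"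
    by (intro integral_cong_AE meas ae) measurable
  ultimately show ?thesis
    using ac by (simp add: ext_KL_divergence_def KL_divergence_def)
qed

text \<open>Since \<open>P\<close> is sigma-finite, the \<open>ennreal\<close>-valued derivative is
  finite almost everywhere, so passing to \<open>enn2real\<close> changes it only on a null set.
  Real densities allow logarithms and Bochner integrals to be used directly.\<close>

lemma absolutely_continuous_real_densityE:
  assumes "prob_space Q" "prob_space P" "sets P = sets Q" "absolutely_continuous Q P"
  obtains d :: "'a \<Rightarrow> real" where "d \<in> borel_measurable Q" "\<And>x. 0 \<le> d x" "P = density Q d"
proof -
  interpret Q: prob_space Q by fact
  interpret P: prob_space P by fact
  have "AE x in Q. RN_deriv Q P x \<noteq> \<infinity>"
    by (intro Q.RN_deriv_finite assms P.sigma_finite_measure_axioms)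
  then have "density Q (\<lambda>x. ennreal (enn2real (RN_deriv Q P x))) = density Q (RN_deriv Q P)"
    by (intro density_cong) (auto simp: ennreal_enn2real_if)
  with Q.density_RN_deriv[OF assms(4,3)] show ?thesis
    by (intro that[of "\<lambda>x. enn2real (RN_deriv Q P x)"]) simp_all
qed

lemma ext_KL_divergence_finiteE:
  assumes "prob_space Q" "prob_space P" "sets P = sets Q" "ext_KL_divergence b Q P \<noteq> \<infinity>"
  obtains d where "d \<in> borel_measurable Q" "\<And>x. 0 \<le> d x" "P = density Q d"
    "integrable P (\<lambda>x. log b (d x))" "ext_KL_divergence b Q P = ennreal (\<integral>x. log b (d x) \<partial>P)"
proof -
  have "absolutely_continuous Q P"
    using assms(4) by (auto simp: ext_KL_divergence_def split: if_splits)
  then obtain d :: "'a \<Rightarrow> real"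
    where d: "d \<in> borel_measurable Q" "\<And>x. 0 \<le> d x" "P = density Q d"
    by (rule absolutely_continuous_real_densityE[OF assms(1-3)]) (rule that)
  then show ?thesis
    using ext_KL_divergence_density[OF assms(1) d(1,2), of b] assms(4)
    by (intro that[of d]) (auto split: if_splits)
qed

text \<open>The product \<open>d x * (f x / d x)\<close> is \<open>f x\<close> where
  \<open>d x > 0\<close> and \<open>0\<close> where \<open>d x = 0\<close>, as division by zero
  gives zero. Hence it is at most \<open>f x\<close>, and equality of the integrals may
  fail.\<close>

lemma integrable_density_inverse_mult:
  fixes d f :: "'a \<Rightarrow> real"
  assumes [measurable]: "d \<in> borel_measurable Q" and nn: "\<And>x. 0 \<le> d x" "\<And>x. 0 \<le> f x"
    and f: "integrable Q f"
  shows "integrable (density Q d) (\<lambda>x. f x / d x)"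
    "(\<integral>x. f x / d x \<partial>density Q d) \<le> (\<integral>x. f x \<partial>Q)"
proof -
  have [measurable]: "f \<in> borel_measurable Q" using f by auto
  have i: "integrable Q (\<lambda>x. d x * (f x / d x))"
    by (rule Bochner_Integration.integrable_bound[OF f]) (use nn in auto)
  then show "integrable (density Q d) (\<lambda>x. f x / d x)"
    using nn by (simp add: integrable_density)
  have "(\<integral>x. f x / d x \<partial>density Q d) = (\<integral>x. d x * (f x / d x) \<partial>Q)"
    using nn by (simp add: integral_density)
  also have "\<dots> \<le> (\<integral>x. f x \<partial>Q)"
    by (intro integral_mono i f) (use nn in auto)
  finally show "(\<integral>x. f x / d x \<partial>density Q d) \<le> (\<integral>x. f x \<partial>Q)" .
qed

lemma AE_density_pos:
  fixes d :: "'a \<Rightarrow> real"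
  assumes "d \<in> borel_measurable Q"
  shows "AE x in density Q d. 0 < d x"
  using assms by (simp add: AE_density)

section \<open>Behaviour of the divergence under images, independent factors and change of reference
  measure\<close>

text \<open>Data processing, obtained from \<open>ln t \<le> t - 1\<close> without conditional
  expectations: if \<open>c\<close> is the density of the image measures,
  \<open>log b (c (T x))\<close> exceeds \<open>log b (d x)\<close> by at most
  \<open>(c (T x) / d x - 1) / ln b\<close>, and the \<open>P\<close>-integral of this excess is at
  most zero.\<close>

lemma ext_KL_divergence_distr_le:
  assumes b: "1 < b" and Q: "prob_space Q" and P: "prob_space P" and sPQ: "sets P = sets Q"
    and T: "T \<in> Q \<rightarrow>\<^sub>M N"
  shows "ext_KL_divergence b (distr Q N T) (distr P N T) \<le> ext_KL_divergence b Q P"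
proof (cases "ext_KL_divergence b Q P = \<infinity>")
  case False
  note [measurable] = T
  interpret Q: prob_space Q by fact
  interpret P: prob_space P by fact
  have [measurable]: "T \<in> P \<rightarrow>\<^sub>M N" using T by (simp add: measurable_cong_sets[OF sPQ refl])
  interpret QT: prob_space "distr Q N T" by (rule Q.prob_space_distr) fact
  interpret PT: prob_space "distr P N T" by (rule P.prob_space_distr) fact
  obtain d where d [measurable]: "d \<in> borel_measurable Q" and d0: "\<And>x. 0 \<le> d x"
    and Pd: "P = density Q d" and id: "integrable P (\<lambda>x. log b (d x))"
    and KL: "ext_KL_divergence b Q P = ennreal (\<integral>x. log b (d x) \<partial>P)"
    by (rule ext_KL_divergence_finiteE[OF Q P sPQ False]) (rule that)
  have ac: "absolutely_continuous (distr Q N T) (distr P N T)"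
  proof -
    have "absolutely_continuous Q P"
      using False by (auto simp: ext_KL_divergence_def split: if_splits)
    then show ?thesis
      using sets_eq_imp_space_eq[OF sPQ]
      by (auto simp: absolutely_continuous_def null_sets_distr_iff)
  qed
  obtain c :: "_ \<Rightarrow> real" where c: "c \<in> borel_measurable (distr Q N T)" and c0: "\<And>x. 0 \<le> c x"
    and Pc: "distr P N T = density (distr Q N T) c"
    by (rule absolutely_continuous_real_densityE[OF QT.prob_space_axioms PT.prob_space_axioms _ ac,
          unfolded sets_distr, OF refl]) (rule that)
  have [measurable]: "c \<in> borel_measurable N" using c by simp
  have dpos: "AE x in P. 0 < d x"
    unfolding Pd by (rule AE_density_pos) fact
  have "AE x in distr P N T. 0 < c x"
    unfolding Pc by (rule AE_density_pos) fact
  then have cpos: "AE x in P. 0 < c (T x)"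
    by (simp add: AE_distr_iff)
  \<comment> \<open>The value 1 is the total mass of \<open>distr P N T\<close>, computed through
    its density \<open>c\<close>.\<close>
  have ic: "integrable Q (\<lambda>x. c (T x))" "(\<integral>x. c (T x) \<partial>Q) = 1"
  proof -
    have "(\<integral>\<^sup>+x. ennreal (c x) \<partial>distr Q N T) = emeasure (distr P N T) (space (distr P N T))"
      unfolding Pc by (subst emeasure_density) (auto intro!: nn_integral_cong)
    then have *: "(\<integral>\<^sup>+x. ennreal (c (T x)) \<partial>Q) = ennreal 1"
      using PT.emeasure_space_1 by (simp add: nn_integral_distr)
    show "integrable Q (\<lambda>x. c (T x))" 
      using * c0 by (intro integrableI_nonneg) auto
    show "(\<integral>x. c (T x) \<partial>Q) = 1"
      using * c0 by (intro integral_eq_nn_integral[THEN trans]) auto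
  qed
  have icd: "integrable P (\<lambda>x. c (T x) / d x)" "(\<integral>x. c (T x) / d x \<partial>P) \<le> 1"
    using integrable_density_inverse_mult[OF d d0 c0 ic(1)] ic(2) by (simp_all add: Pd)
  \<comment> \<open>This is the case \<open>f = 1\<close>: integrating \<open>1 / c\<close> against
    the density \<open>c\<close> gives at most the mass of \<open>distr Q N T\<close>.\<close>
  have "integrable (distr P N T) (\<lambda>x. 1 / c x)"
    unfolding Pc by (rule integrable_density_inverse_mult[OF c c0]) auto
  then have ic1: "integrable P (\<lambda>x. 1 / c (T x))"
    by (simp add: integrable_distr_eq)
  \<comment> \<open>\<open>ln t \<le> t - 1\<close> at \<open>t = (c \<circ> T) / d\<close> and at \<open>t = 1 / (c \<circ> T)\<close> bounds \<open>log b \<circ> c \<circ> T\<close>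
    on both sides by \<open>P\<close>-integrable functions\<close>
  have lnb: "0 < ln b" using b by simp
  have upper: "AE x in P. log b (c (T x)) \<le> log b (d x) + (c (T x) / d x - 1) / ln b"
    using dpos cpos
  proof eventually_elim
    case (elim x)
    have "ln (c (T x)) - ln (d x) \<le> c (T x) / d x - 1"
      using ln_le_minus_one[of "c (T x) / d x"] elim by (simp add: ln_div)
    then show ?case
      using lnb by (simp add: log_def field_simps)
  qed
  have lower: "AE x in P. (1 - 1 / c (T x)) / ln b \<le> log b (c (T x))"
    using cpos
  proof eventually_elim
    case (elim x)
    have "- ln (c (T x)) \<le> 1 / c (T x) - 1"
      using ln_le_minus_one[of "1 / c (T x)"] elim by (simp add: ln_div)
    then show ?case
      using lnb by (simp add: log_def divide_right_mono)
  qed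
  have iu: "integrable P (\<lambda>x. log b (d x) + (c (T x) / d x - 1) / ln b)"
    using id icd by auto
  have il: "integrable P (\<lambda>x. (1 - 1 / c (T x)) / ln b)"
    using ic1 by auto
  have abs_bound: "norm x \<le> norm (\<bar>u\<bar> + \<bar>l\<bar>)" if "l \<le> x" "x \<le> u" for l x u :: real
    using that by simp
  \<comment> \<open>An upper bound on the integral alone would not suffice: without integrability
    the divergence of the images would be infinite by definition.\<close>
  have i: "integrable P (\<lambda>x. log b (c (T x)))"
  proof (rule Bochner_Integration.integrable_bound)
    show "integrable P (\<lambda>x. \<bar>log b (d x) + (c (T x) / d x - 1) / ln b\<bar> + \<bar>(1 - 1 / c (T x)) / ln b\<bar>)"
      by (intro Bochner_Integration.integrable_add integrable_abs iu il)
    show "AE x in P. norm (log b (c (T x)))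
        \<le> norm (\<bar>log b (d x) + (c (T x) / d x - 1) / ln b\<bar> + \<bar>(1 - 1 / c (T x)) / ln b\<bar>)"
      using lower upper by eventually_elim (rule abs_bound)
  qed measurable
  have "(\<integral>x. log b (c (T x)) \<partial>P) \<le> (\<integral>x. log b (d x) + (c (T x) / d x - 1) / ln b \<partial>P)"
    by (rule integral_mono_AE[OF i iu upper])
  also have "\<dots> = (\<integral>x. log b (d x) \<partial>P) + ((\<integral>x. c (T x) / d x \<partial>P) - 1) / ln b"
    using id icd P.prob_space by (simp add: Bochner_Integration.integral_diff)
  also have "\<dots> \<le> (\<integral>x. log b (d x) \<partial>P)"
    using icd(2) lnb by (simp add: divide_nonpos_pos)
  finally have le: "(\<integral>x. log b (c (T x)) \<partial>P) \<le> (\<integral>x. log b (d x) \<partial>P)" .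
  have "ext_KL_divergence b (distr Q N T) (distr P N T)
      = ennreal (\<integral>x. log b (c x) \<partial>distr P N T)"
    using ext_KL_divergence_density[OF QT.prob_space_axioms c c0, of b] i
    by (simp add: Pc[symmetric] integrable_distr_eq)
  also have "\<dots> \<le> ext_KL_divergence b Q P"
    using le by (simp add: KL integral_distr ennreal_leI)
  finally show ?thesis .
qed simp

text \<open>The density of the products is \<open>d\<close> applied to the first coordinate, and the
  first marginal of \<open>P \<Otimes>\<^sub>M N\<close> is \<open>P\<close>, so the integral of the
  logarithm is unchanged. This allows independent noise to be appended at no cost.\<close>

lemma ext_KL_divergence_pair_le:
  assumes Q: "prob_space Q" and P: "prob_space P" and sPQ: "sets P = sets Q" and N: "prob_space N"
  shows "ext_KL_divergence b (Q \<Otimes>\<^sub>M N) (P \<Otimes>\<^sub>M N) \<le> ext_KL_divergence b Q P"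
proof (cases "ext_KL_divergence b Q P = \<infinity>")
  case False
  interpret Q: prob_space Q by fact
  interpret P: prob_space P by fact
  interpret N: prob_space N by fact
  interpret PN: pair_prob_space P N ..
  interpret QN: pair_prob_space Q N ..
  obtain d where d [measurable]: "d \<in> borel_measurable Q" and d0: "\<And>x. 0 \<le> d x"
    and Pd: "P = density Q d" and id: "integrable P (\<lambda>x. log b (d x))"
    and KL: "ext_KL_divergence b Q P = ennreal (\<integral>x. log b (d x) \<partial>P)"
    by (rule ext_KL_divergence_finiteE[OF Q P sPQ False]) (rule that)
  have dP: "d \<in> borel_measurable P" by (simp add: Pd)
  \<comment> \<open>Writing \<open>N\<close> as a density with constant value 1 brings the product
    into the form of \<open>pair_measure_density\<close>.\<close>
  have "P \<Otimes>\<^sub>M density N (\<lambda>_. 1) = density (Q \<Otimes>\<^sub>M N) (\<lambda>(x, y). ennreal (d x) * 1)"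
    unfolding Pd
    by (rule pair_measure_density) (auto simp: density_1 N.sigma_finite_measure_axioms)
  then have PN: "P \<Otimes>\<^sub>M N = density (Q \<Otimes>\<^sub>M N) (\<lambda>x. ennreal (d (fst x)))"
    by (simp add: density_1 split_beta')
  have fstd: "distr (P \<Otimes>\<^sub>M N) P fst = P"
    by (rule N.distr_pair_fst)
  have i: "integrable (P \<Otimes>\<^sub>M N) (\<lambda>x. log b (d (fst x)))"
    using id dP by (subst (asm) fstd[symmetric]) (simp add: integrable_distr_eq)
  have "(\<integral>x. log b (d x) \<partial>P) = (\<integral>x. log b (d (fst x)) \<partial>(P \<Otimes>\<^sub>M N))"
    using dP by (subst fstd[symmetric]) (simp add: integral_distr)
  then show ?thesis
    using ext_KL_divergence_density[OF QN.prob_space_axioms, of "\<lambda>x. d (fst x)" b] i d0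
    by (simp add: PN[symmetric] KL)
qed simp

text \<open>Densities multiply along the chain from \<open>R\<close> through
  \<open>density R \<phi>\<close> to \<open>P\<close>, and the logarithm of the product splits
  \<open>P\<close>-almost everywhere, where both factors are positive.\<close>

lemma ext_KL_divergence_trans_le:
  assumes b: "1 < b" and R: "prob_space R"
    and phi [measurable]: "\<phi> \<in> borel_measurable R" and phi0: "\<And>x. 0 \<le> \<phi> x"
    and Q: "prob_space (density R \<phi>)"
    and P: "prob_space P" and sPR: "sets P = sets R"
    and i: "integrable P (\<lambda>x. log b (\<phi> x))"
  shows "ext_KL_divergence b R P
    \<le> ext_KL_divergence b (density R \<phi>) P + ennreal (\<integral>x. log b (\<phi> x) \<partial>P)"
proof (cases "ext_KL_divergence b (density R \<phi>) P = \<infinity>")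
  case False
  obtain d where d [measurable]: "d \<in> borel_measurable R" and d0: "\<And>x. 0 \<le> d x"
    and Pd: "P = density (density R \<phi>) d" and id: "integrable P (\<lambda>x. log b (d x))"
    and KL: "ext_KL_divergence b (density R \<phi>) P = ennreal (\<integral>x. log b (d x) \<partial>P)"
    by (rule ext_KL_divergence_finiteE[OF Q P _ False, unfolded sets_density, OF sPR]) (rule that, simp_all)
  have PR: "P = density R (\<lambda>x. \<phi> x * d x)"
    unfolding Pd using phi0 by (subst density_density_eq) (auto simp: ennreal_mult')
  have "AE x in P. 0 < \<phi> x * d x"
    unfolding PR by (rule AE_density_pos) measurable
  then have ae: "AE x in P. log b (\<phi> x * d x) = log b (\<phi> x) + log b (d x)"
  proof eventually_elim
    case (elim x)
    then show ?case
      using d0[of x] phi0[of x] by (simp add: log_mult zero_less_mult_iff)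
  qed
  have [measurable]: "\<phi> \<in> borel_measurable P" "d \<in> borel_measurable P"
    by (simp_all add: Pd)
  have "integrable P (\<lambda>x. log b (\<phi> x * d x))"
    using ae i id by (subst integrable_cong_AE[OF _ _ ae]) auto
  moreover have "(\<integral>x. log b (\<phi> x * d x) \<partial>P) = (\<integral>x. log b (\<phi> x) \<partial>P) + (\<integral>x. log b (d x) \<partial>P)"
    using i id by (subst integral_cong_AE[OF _ _ ae]) auto
  ultimately have "ext_KL_divergence b R P
      = ennreal ((\<integral>x. log b (d x) \<partial>P) + (\<integral>x. log b (\<phi> x) \<partial>P))"
    using ext_KL_divergence_density[OF R, of "\<lambda>x. \<phi> x * d x" b] phi0 d0
    by (simp add: PR[symmetric] add.commute)
  \<comment> \<open>Only an inequality, because \<open>ennreal\<close> sends negative reals to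
    zero.\<close>
  also have "\<dots> \<le> ennreal (\<integral>x. log b (d x) \<partial>P) + ennreal (\<integral>x. log b (\<phi> x) \<partial>P)"
    by (auto simp: ennreal_plus_if intro: ennreal_leI)
  finally show ?thesis by (simp add: KL)
qed simp

section \<open>Conditional products\<close>

text \<open>Rectangles are an intersection-stable generator containing the whole space. The second
  factor may itself be a product, which is how laws of triples are compared below.\<close>

lemma finite_measure_eqI_Times:
  assumes s: "sets P = sets (MX \<Otimes>\<^sub>M MY)" "sets Q = sets (MX \<Otimes>\<^sub>M MY)" and P: "finite_measure P"
    and eq: "\<And>A B. A \<in> sets MX \<Longrightarrow> B \<in> sets MY \<Longrightarrow> emeasure P (A \<times> B) = emeasure Q (A \<times> B)"
  shows "P = Q"
proof (rule measure_eqI_generator_eq[where E="{A \<times> B | A B. A \<in> sets MX \<and> B \<in> sets MY}"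
      and \<Omega>="space MX \<times> space MY" and A="\<lambda>_::nat. space MX \<times> space MY"])
  show "Int_stable {A \<times> B | A B. A \<in> sets MX \<and> B \<in> sets MY}"
    by (rule Int_stable_pair_measure_generator)
  show "{A \<times> B | A B. A \<in> sets MX \<and> B \<in> sets MY} \<subseteq> Pow (space MX \<times> space MY)"
    by (auto dest: sets.sets_into_space)
  show "emeasure P (space MX \<times> space MY) \<noteq> \<infinity>"
    using finite_measure.emeasure_finite[OF P] by simp
qed (use s eq in \<open>auto simp: sets_pair_measure\<close>)


text \<open>The measure sending \<open>B\<close> to the probability of \<open>X \<in> A\<close> and
  \<open>Z \<in> B\<close> has density \<open>emeasure (K z) A\<close> with respect to the law of
  \<open>Z\<close>; integrating \<open>F\<close> against it in both descriptions extends the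
  defining identity from indicators to \<open>F\<close>.\<close>

lemma nn_integral_regular_cond_distr:
  assumes M: "prob_space M" and X [measurable]: "X \<in> M \<rightarrow>\<^sub>M MX" and Z [measurable]: "Z \<in> M \<rightarrow>\<^sub>M MZ"
    and K: "regular_cond_distr M MX MZ X Z K" and A [measurable]: "A \<in> sets MX"
    and F [measurable]: "F \<in> borel_measurable MZ"
  shows "(\<integral>\<^sup>+\<omega>. indicator A (X \<omega>) * F (Z \<omega>) \<partial>M) = (\<integral>\<^sup>+z. emeasure (K z) A * F z \<partial>distr M MZ Z)"
proof -
  have [measurable]: "(\<lambda>z. emeasure (K z) A) \<in> borel_measurable MZ"
    using K measurable_compose[OF measurable_prob_algebraD measurable_emeasure_subprob_algebra[OF A]]
    by (auto simp: regular_cond_distr_def)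
  have eq: "distr (density M (\<lambda>\<omega>. indicator A (X \<omega>))) MZ Z
      = density (distr M MZ Z) (\<lambda>z. emeasure (K z) A)"
  proof (rule measure_eqI)
    fix B assume "B \<in> sets (distr (density M (\<lambda>\<omega>. indicator A (X \<omega>))) MZ Z)"
    then have B [measurable]: "B \<in> sets MZ" by simp
    have "emeasure (distr (density M (\<lambda>\<omega>. indicator A (X \<omega>))) MZ Z) B
        = (\<integral>\<^sup>+\<omega>. indicator {\<omega> \<in> space M. X \<omega> \<in> A \<and> Z \<omega> \<in> B} \<omega> \<partial>M)"
      by (auto simp: emeasure_distr emeasure_density simp del: nn_integral_indicator
          intro!: nn_integral_cong split: split_indicator)
    also have "\<dots> = emeasure M {\<omega> \<in> space M. X \<omega> \<in> A \<and> Z \<omega> \<in> B}"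
      by (rule nn_integral_indicator) measurable
    also have "\<dots> = emeasure (density (distr M MZ Z) (\<lambda>z. emeasure (K z) A)) B"
      using K B A by (simp add: regular_cond_distr_def emeasure_density)
    finally show "emeasure (distr (density M (\<lambda>\<omega>. indicator A (X \<omega>))) MZ Z) B
        = emeasure (density (distr M MZ Z) (\<lambda>z. emeasure (K z) A)) B" .
  qed simp
  have "(\<integral>\<^sup>+\<omega>. indicator A (X \<omega>) * F (Z \<omega>) \<partial>M)
      = (\<integral>\<^sup>+z. F z \<partial>distr (density M (\<lambda>\<omega>. indicator A (X \<omega>))) MZ Z)"
    by (simp add: nn_integral_distr nn_integral_density)
  then show ?thesis
    unfolding eq by (simp add: nn_integral_density)
qed

lemma sets_cond_product:
  assumes "K \<in> MZ \<rightarrow>\<^sub>M prob_algebra MX" "L \<in> MZ \<rightarrow>\<^sub>M prob_algebra MY"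
    and "sets PZ = sets MZ" "space MZ \<noteq> {}"
  shows "sets (cond_product MX MY MZ PZ K L) = sets (MX \<Otimes>\<^sub>M MY \<Otimes>\<^sub>M MZ)"
  unfolding cond_product_def using assms(4) sets_eq_imp_space_eq[OF assms(3)]
  by (intro sets_bind) auto

text \<open>The last two coordinates of the conditional product have the joint law of
  \<open>(Y, Z)\<close>, so the kernel \<open>L\<close> disappears and only \<open>K\<close>
  remains. For fixed \<open>A\<close> both sides are finite measures in \<open>D\<close> and need
  comparison on rectangles only.\<close>

lemma emeasure_cond_product:
  assumes M: "prob_space M" and Y [measurable]: "Y \<in> M \<rightarrow>\<^sub>M MY" and Z [measurable]: "Z \<in> M \<rightarrow>\<^sub>M MZ"
    and K: "K \<in> MZ \<rightarrow>\<^sub>M prob_algebra MX" and L: "regular_cond_distr M MY MZ Y Z L"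
    and A [measurable]: "A \<in> sets MX" and D [measurable]: "D \<in> sets (MY \<Otimes>\<^sub>M MZ)"
  shows "emeasure (cond_product MX MY MZ (distr M MZ Z) K L) (A \<times> D)
    = (\<integral>\<^sup>+\<omega>. emeasure (K (Z \<omega>)) A * indicator D (Y \<omega>, Z \<omega>) \<partial>M)"
proof -
  interpret prob_space M by fact
  interpret PZ: prob_space "distr M MZ Z" using Z by (rule prob_space_distr)
  let ?Q = "cond_product MX MY MZ (distr M MZ Z) K L"
  have ne: "space MZ \<noteq> {}" using PZ.not_empty by simp
  have L': "L \<in> MZ \<rightarrow>\<^sub>M prob_algebra MY" using L by (simp add: regular_cond_distr_def)
  have sQ [measurable_cong]: "sets ?Q = sets (MX \<Otimes>\<^sub>M MY \<Otimes>\<^sub>M MZ)"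
    using K L' ne by (intro sets_cond_product) auto
  have [measurable]: "(\<lambda>z. emeasure (K z) A) \<in> borel_measurable MZ"
    using K measurable_compose[OF measurable_prob_algebraD measurable_emeasure_subprob_algebra[OF A]]
    by auto
  have [measurable]: "(\<lambda>z. emeasure (L z) B) \<in> borel_measurable MZ" if "B \<in> sets MY" for B
    using L' measurable_compose[OF measurable_prob_algebraD measurable_emeasure_subprob_algebra[OF that]]
    by auto
  have K_le: "emeasure (K z) A \<le> 1" if "z \<in> space MZ" for z
    using measurable_space[OF K that]
    by (auto simp: space_prob_algebra intro: prob_space.emeasure_le_1)
  let ?\<mu> = "distr (density ?Q (\<lambda>x. indicator A (fst x))) (MY \<Otimes>\<^sub>M MZ) snd"
  let ?\<nu> = "distr (density M (\<lambda>\<omega>. emeasure (K (Z \<omega>)) A)) (MY \<Otimes>\<^sub>M MZ) (\<lambda>\<omega>. (Y \<omega>, Z \<omega>))"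
  have mu: "emeasure ?\<mu> E = emeasure ?Q (A \<times> E)" if [measurable]: "E \<in> sets (MY \<Otimes>\<^sub>M MZ)" for E
  proof -
    have "emeasure ?\<mu> E = (\<integral>\<^sup>+x. indicator (A \<times> E) x \<partial>?Q)"
      by (auto simp: emeasure_distr emeasure_density simp del: nn_integral_indicator
          intro!: nn_integral_cong split: split_indicator)
    also have "\<dots> = emeasure ?Q (A \<times> E)"
      by (rule nn_integral_indicator) measurable
    finally show ?thesis .
  qed
  have nu: "emeasure ?\<nu> E = (\<integral>\<^sup>+\<omega>. emeasure (K (Z \<omega>)) A * indicator E (Y \<omega>, Z \<omega>) \<partial>M)"
    if [measurable]: "E \<in> sets (MY \<Otimes>\<^sub>M MZ)" for E
    by (auto simp: emeasure_distr emeasure_density simp del: nn_integral_indicator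
          intro!: nn_integral_cong split: split_indicator)
  have "?\<nu> = ?\<mu>"
  proof (rule finite_measure_eqI_Times)
    show "finite_measure ?\<nu>"
    proof
      have "emeasure ?\<nu> (space ?\<nu>) \<le> (\<integral>\<^sup>+\<omega>. 1 \<partial>M)"
        unfolding space_distr using K_le measurable_space[OF Z]
        by (subst nu, simp, intro nn_integral_mono) (auto split: split_indicator)
      then show "emeasure ?\<nu> (space ?\<nu>) \<noteq> \<infinity>"
        by (auto simp: emeasure_space_1 top_unique)
    qed
  next
    fix B C assume [measurable]: "B \<in> sets MY" "C \<in> sets MZ"
    have "emeasure ?\<mu> (B \<times> C) = (\<integral>\<^sup>+z. emeasure (L z) B * (emeasure (K z) A * indicator C z) \<partial>distr M MZ Z)"
      using K L' ne by (simp add: mu emeasure_cond_product_Times ac_simps)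
    \<comment> \<open>Here \<open>L\<close> is traded for the variable \<open>Y\<close>; the factor
      with \<open>K\<close> is a function of \<open>Z\<close> and is carried along as
      \<open>F\<close>.\<close>
    also have "\<dots> = (\<integral>\<^sup>+\<omega>. indicator B (Y \<omega>) * (emeasure (K (Z \<omega>)) A * indicator C (Z \<omega>)) \<partial>M)"
      by (rule nn_integral_regular_cond_distr[OF M Y Z L, symmetric]) measurable
    also have "\<dots> = emeasure ?\<nu> (B \<times> C)"
      by (subst nu) (auto intro!: nn_integral_cong split: split_indicator)
    finally show "emeasure ?\<nu> (B \<times> C) = emeasure ?\<mu> (B \<times> C)" ..
  qed simp_all
  then show ?thesis
    using mu[OF D] nu[OF D] by simp
qed

lemma prob_space_cond_product:
  assumes M: "prob_space M" and Y: "Y \<in> M \<rightarrow>\<^sub>M MY" and Z: "Z \<in> M \<rightarrow>\<^sub>M MZ"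
    and K: "K \<in> MZ \<rightarrow>\<^sub>M prob_algebra MX" and L: "regular_cond_distr M MY MZ Y Z L"
  shows "prob_space (cond_product MX MY MZ (distr M MZ Z) K L)" (is "prob_space ?Q")
proof
  interpret prob_space M by fact
  have ne: "space MZ \<noteq> {}" using not_empty measurable_space[OF Z] by auto
  have L': "L \<in> MZ \<rightarrow>\<^sub>M prob_algebra MY" using L by (simp add: regular_cond_distr_def)
  have "space ?Q = space MX \<times> space (MY \<Otimes>\<^sub>M MZ)"
    using sets_eq_imp_space_eq[OF sets_cond_product[OF K L' _ ne]] by (simp add: space_pair_measure)
  moreover have "emeasure (K (Z \<omega>)) (space MX) = 1" if "\<omega> \<in> space M" for \<omega>
    using measurable_space[OF K measurable_space[OF Z that]]
    by (auto simp: space_prob_algebra prob_space.emeasure_space_1 dest!: sets_eq_imp_space_eq[symmetric])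
  moreover have "indicator (space (MY \<Otimes>\<^sub>M MZ)) (Y \<omega>, Z \<omega>) = (1 :: ennreal)" if "\<omega> \<in> space M" for \<omega>
    using measurable_space[OF Y that] measurable_space[OF Z that] by (simp add: space_pair_measure)
  ultimately have "emeasure ?Q (space ?Q) = (\<integral>\<^sup>+\<omega>. 1 \<partial>M)"
    using emeasure_cond_product[OF M Y Z K L sets.top sets.top] by (simp cong: nn_integral_cong)
  then show "emeasure ?Q (space ?Q) = 1"
    by (simp add: emeasure_space_1)
qed

section \<open>Chain rule with data processing\<close>

text \<open>The common core of both inequalities. For the first, \<open>U\<close>, \<open>V\<close>,
  \<open>W\<close>, \<open>W'\<close> and \<open>e\<close> are \<open>S\<close>,
  \<open>Shat\<close>, \<open>ZhatS\<close>, \<open>ZhatC\<close> and \<open>eps\<close>; the second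
  exchanges the roles. The hypotheses say that \<open>V\<close> is generated from
  \<open>(W', W)\<close> and noise independent of \<open>(U, W', W)\<close>.\<close>

lemma ext_mutual_information_le_chain:
  fixes MU :: "'u measure" and MW :: "'w measure" and MW' :: "'w1 measure"
  assumes b: "1 < b" and M: "prob_space M"
    and U [measurable]: "U \<in> M \<rightarrow>\<^sub>M MU" and V [measurable]: "V \<in> M \<rightarrow>\<^sub>M MV"
    and W [measurable]: "W \<in> M \<rightarrow>\<^sub>M MW" and W' [measurable]: "W' \<in> M \<rightarrow>\<^sub>M MW'"
    and e [measurable]: "e \<in> M \<rightarrow>\<^sub>M ME"
    and h [measurable]: "h \<in> (MW' \<Otimes>\<^sub>M MW) \<Otimes>\<^sub>M ME \<rightarrow>\<^sub>M MV"
    and Vh: "AE \<omega> in M. V \<omega> = h ((W' \<omega>, W \<omega>), e \<omega>)"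
    and indep: "distr M ((MU \<Otimes>\<^sub>M MW' \<Otimes>\<^sub>M MW) \<Otimes>\<^sub>M ME) (\<lambda>\<omega>. ((U \<omega>, W' \<omega>, W \<omega>), e \<omega>))
      = distr M (MU \<Otimes>\<^sub>M MW' \<Otimes>\<^sub>M MW) (\<lambda>\<omega>. (U \<omega>, W' \<omega>, W \<omega>)) \<Otimes>\<^sub>M distr M ME e"
  shows "ext_mutual_information b M MU MV U V
    \<le> ext_mutual_information b M MV MW V W + ext_cond_mutual_information b M MU MW' MW U W' W"
\<comment> \<open>If no versions of the conditional laws exist, the conditional mutual information
  is an infimum over the empty set, hence infinite, and the bound is trivial.\<close>
proof (cases "ext_mutual_information b M MV MW V W = \<infinity> \<or>
    \<not> (\<exists>K L. regular_cond_distr M MU MW U W K \<and> regular_cond_distr M MW' MW W' W L)")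
  case True
  then show ?thesis
  proof
    assume "\<not> (\<exists>K L. regular_cond_distr M MU MW U W K \<and> regular_cond_distr M MW' MW W' W L)"
    then have "{(K, L). regular_cond_distr M MU MW U W K \<and> regular_cond_distr M MW' MW W' W L} = {}"
      by auto
    then have "ext_cond_mutual_information b M MU MW' MW U W' W = \<infinity>"
      unfolding ext_cond_mutual_information_def by (simp only: image_empty Inf_empty infinity_ennreal_def)
    then show ?thesis by simp
  qed simp
next
  case False
  then obtain K L where K: "regular_cond_distr M MU MW U W K"
    and L: "regular_cond_distr M MW' MW W' W L" by blast
  from False have fin: "ext_mutual_information b M MV MW V W \<noteq> \<infinity>" by simp
  have K': "K \<in> MW \<rightarrow>\<^sub>M prob_algebra MU" and L': "L \<in> MW \<rightarrow>\<^sub>M prob_algebra MW'"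
    using K L by (auto simp: regular_cond_distr_def)
  interpret prob_space M by fact
  \<comment> \<open>\<open>P1\<close> and \<open>Q1\<close> are the two measures whose divergence is
    the conditional term. \<open>T\<close> runs the generator and forgets \<open>W'\<close>;
    \<open>P3\<close> is the true law of \<open>(U, V, W)\<close>, while \<open>R\<close> makes
    \<open>V\<close> independent of \<open>(U, W)\<close>.\<close>
  define P1 where "P1 = distr M (MU \<Otimes>\<^sub>M MW' \<Otimes>\<^sub>M MW) (\<lambda>\<omega>. (U \<omega>, W' \<omega>, W \<omega>))"
  define Q1 where "Q1 = cond_product MU MW' MW (distr M MW W) K L"
  define N where "N = distr M ME e"
  define T where "T = (\<lambda>x :: ('u \<times> 'w1 \<times> 'w) \<times> _. (fst (fst x), h (snd (fst x), snd x), snd (snd (fst x))))"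
  define P3 where "P3 = distr M (MU \<Otimes>\<^sub>M MV \<Otimes>\<^sub>M MW) (\<lambda>\<omega>. (U \<omega>, V \<omega>, W \<omega>))"
  define PUW where "PUW = distr M (MU \<Otimes>\<^sub>M MW) (\<lambda>\<omega>. (U \<omega>, W \<omega>))"
  define PV where "PV = distr M MV V"
  define PW where "PW = distr M MW W"
  define PVW where "PVW = distr M (MV \<Otimes>\<^sub>M MW) (\<lambda>\<omega>. (V \<omega>, W \<omega>))"
  define R where "R = distr (PV \<Otimes>\<^sub>M PUW) (MU \<Otimes>\<^sub>M MV \<Otimes>\<^sub>M MW) (\<lambda>(v, u, w). (u, v, w))"
  have ne: "space MW \<noteq> {}" using not_empty measurable_space[OF W] by auto
  have [measurable_cong]: "sets P1 = sets (MU \<Otimes>\<^sub>M MW' \<Otimes>\<^sub>M MW)" "sets N = sets ME"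
    "sets P3 = sets (MU \<Otimes>\<^sub>M MV \<Otimes>\<^sub>M MW)" "sets PUW = sets (MU \<Otimes>\<^sub>M MW)" "sets PV = sets MV"
    "sets PW = sets MW" "sets PVW = sets (MV \<Otimes>\<^sub>M MW)" "sets R = sets (MU \<Otimes>\<^sub>M MV \<Otimes>\<^sub>M MW)"
    by (simp_all add: P1_def N_def P3_def PUW_def PV_def PW_def PVW_def R_def)
  have sQ1 [measurable_cong]: "sets Q1 = sets (MU \<Otimes>\<^sub>M MW' \<Otimes>\<^sub>M MW)"
    unfolding Q1_def using K' L' ne by (intro sets_cond_product) auto
  have [measurable]: "T \<in> (MU \<Otimes>\<^sub>M MW' \<Otimes>\<^sub>M MW) \<Otimes>\<^sub>M ME \<rightarrow>\<^sub>M MU \<Otimes>\<^sub>M MV \<Otimes>\<^sub>M MW"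
    unfolding T_def by measurable
  interpret P1: prob_space P1 unfolding P1_def by (rule prob_space_distr) measurable
  interpret N: prob_space N unfolding N_def by (rule prob_space_distr) measurable
  interpret P3: prob_space P3 unfolding P3_def by (rule prob_space_distr) measurable
  interpret PUW: prob_space PUW unfolding PUW_def by (rule prob_space_distr) measurable
  interpret PV: prob_space PV unfolding PV_def by (rule prob_space_distr) measurable
  interpret PW: prob_space PW unfolding PW_def by (rule prob_space_distr) measurable
  interpret PVW: prob_space PVW unfolding PVW_def by (rule prob_space_distr) measurable
  interpret Q1: prob_space Q1 unfolding Q1_def by (rule prob_space_cond_product[OF M W' W K' L])
  interpret P1N: pair_prob_space P1 N ..
  interpret Q1N: pair_prob_space Q1 N ..
  interpret PVUW: pair_prob_space PV PUW ..
  interpret PVPW: pair_prob_space PV PW ..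
  interpret R: prob_space R unfolding R_def by (rule PVUW.prob_space_distr) measurable
  have P3: "P3 = distr (P1 \<Otimes>\<^sub>M N) (MU \<Otimes>\<^sub>M MV \<Otimes>\<^sub>M MW) T"
  proof -
    have "distr (P1 \<Otimes>\<^sub>M N) (MU \<Otimes>\<^sub>M MV \<Otimes>\<^sub>M MW) T
        = distr M (MU \<Otimes>\<^sub>M MV \<Otimes>\<^sub>M MW) (T \<circ> (\<lambda>\<omega>. ((U \<omega>, W' \<omega>, W \<omega>), e \<omega>)))"
      unfolding P1_def N_def indep[symmetric] by (rule distr_distr) measurable
    also have "\<dots> = P3"
      unfolding P3_def by (rule distr_cong_AE) (use Vh in \<open>auto simp: T_def elim: AE_mp\<close>)
    finally show ?thesis ..
  qed
  have fin': "ext_KL_divergence b (PV \<Otimes>\<^sub>M PW) PVW \<noteq> \<infinity>"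
    using fin by (simp add: ext_mutual_information_def PV_def PW_def PVW_def)
  obtain \<phi> where \<phi>: "\<phi> \<in> borel_measurable (PV \<Otimes>\<^sub>M PW)" and \<phi>0: "\<And>x. 0 \<le> \<phi> x"
    and PVW: "PVW = density (PV \<Otimes>\<^sub>M PW) \<phi>" and i\<phi>: "integrable PVW (\<lambda>x. log b (\<phi> x))"
    and KL\<phi>: "ext_KL_divergence b (PV \<Otimes>\<^sub>M PW) PVW = ennreal (\<integral>x. log b (\<phi> x) \<partial>PVW)"
    by (rule ext_KL_divergence_finiteE[OF PVPW.prob_space_axioms PVW.prob_space_axioms _ fin'])
      (simp add: PVW_def PV_def PW_def cong: sets_pair_measure_cong, rule that)
  have [measurable]: "\<phi> \<in> borel_measurable (MV \<Otimes>\<^sub>M MW)" using \<phi> by measurable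
  \<comment> \<open>Both measures give \<open>(V, W)\<close> its true law and draw \<open>U\<close>
    from \<open>K\<close> at \<open>W\<close>. Accordingly both masses of
    \<open>A \<times> D\<close> are reduced to the expectation \<open>?I\<close>.\<close>
  have Q3: "distr (Q1 \<Otimes>\<^sub>M N) (MU \<Otimes>\<^sub>M MV \<Otimes>\<^sub>M MW) T = density R (\<lambda>x. \<phi> (snd x))" (is "?Q3 = _")
  proof (rule finite_measure_eqI_Times)
    show "finite_measure ?Q3"
      by (intro prob_space.finite_measure Q1N.prob_space_distr) measurable
    fix A D assume A [measurable]: "A \<in> sets MU" and D [measurable]: "D \<in> sets (MV \<Otimes>\<^sub>M MW)"
    have [measurable]: "(\<lambda>z. emeasure (K z) A) \<in> borel_measurable MW"
      using K' measurable_compose[OF measurable_prob_algebraD measurable_emeasure_subprob_algebra[OF A]]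
      by auto
    let ?D = "\<lambda>y. {x \<in> space (MW' \<Otimes>\<^sub>M MW). (h (x, y), snd x) \<in> D}"
    let ?\<Phi> = "\<lambda>(x, y). emeasure (K (snd (snd x))) A * indicator D (h (snd x, y), snd (snd x))"
    let ?I = "\<integral>\<^sup>+\<omega>. emeasure (K (W \<omega>)) A * indicator D (V \<omega>, W \<omega>) \<partial>M"
    have sp: "space (Q1 \<Otimes>\<^sub>M N) = (space MU \<times> space (MW' \<Otimes>\<^sub>M MW)) \<times> space ME"
      "space Q1 = space MU \<times> space (MW' \<Otimes>\<^sub>M MW)" "space N = space ME"
      using sets_eq_imp_space_eq[OF sQ1] by (simp_all add: space_pair_measure N_def)
    have "emeasure ?Q3 (A \<times> D) = emeasure (Q1 \<Otimes>\<^sub>M N) (T -` (A \<times> D) \<inter> space (Q1 \<Otimes>\<^sub>M N))"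
      by (rule emeasure_distr) measurable
    also have "\<dots> = (\<integral>\<^sup>+y. emeasure Q1 ((\<lambda>x. (x, y)) -` (T -` (A \<times> D) \<inter> space (Q1 \<Otimes>\<^sub>M N))) \<partial>N)"
      by (rule Q1N.emeasure_pair_measure_alt2) measurable
    \<comment> \<open>With the noise fixed at \<open>y\<close>, the section of the preimage is a
      rectangle \<open>A \<times> ?D y\<close>. The event \<open>A\<close> turns into the weight
      \<open>emeasure (K w) A\<close>, after which \<open>Q1\<close> can be replaced by the true law
      \<open>P1\<close>.\<close>
    also have "\<dots> = (\<integral>\<^sup>+y. \<integral>\<^sup>+x. ?\<Phi> (x, y) \<partial>P1 \<partial>N)"
    proof (rule nn_integral_cong)
      fix y assume "y \<in> space N"
      then have y: "y \<in> space ME" by (simp add: sp)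
      have "(\<lambda>x. (x, y)) -` (T -` (A \<times> D) \<inter> space (Q1 \<Otimes>\<^sub>M N)) = A \<times> ?D y"
        using y sets.sets_into_space[OF A] by (auto simp: sp T_def space_pair_measure)
      moreover have "emeasure Q1 (A \<times> ?D y)
          = (\<integral>\<^sup>+\<omega>. emeasure (K (W \<omega>)) A * indicator (?D y) (W' \<omega>, W \<omega>) \<partial>M)"
        unfolding Q1_def using y by (intro emeasure_cond_product[OF M W' W K' L]) measurable
      moreover have "\<dots> = (\<integral>\<^sup>+\<omega>. ?\<Phi> ((U \<omega>, W' \<omega>, W \<omega>), y) \<partial>M)"
        using measurable_space[OF W] measurable_space[OF W']
        by (auto intro!: nn_integral_cong simp: space_pair_measure split: split_indicator)
      moreover have "\<dots> = (\<integral>\<^sup>+x. ?\<Phi> (x, y) \<partial>P1)"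
        unfolding P1_def using y by (subst nn_integral_distr) auto
      ultimately show "emeasure Q1 ((\<lambda>x. (x, y)) -` (T -` (A \<times> D) \<inter> space (Q1 \<Otimes>\<^sub>M N)))
          = (\<integral>\<^sup>+x. ?\<Phi> (x, y) \<partial>P1)" by simp
    qed
    also have "\<dots> = (\<integral>\<^sup>+z. ?\<Phi> z \<partial>(P1 \<Otimes>\<^sub>M N))"
      by (rule P1N.nn_integral_snd) measurable
    \<comment> \<open>Independence of the noise turns the product measure back into the joint law on
      \<open>M\<close>.\<close>
    also have "\<dots> = (\<integral>\<^sup>+\<omega>. ?\<Phi> ((U \<omega>, W' \<omega>, W \<omega>), e \<omega>) \<partial>M)"
      unfolding P1_def N_def indep[symmetric] by (rule nn_integral_distr) measurable
    also have "\<dots> = ?I"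
      using Vh by (intro nn_integral_cong_AE) (auto elim: AE_mp)
    finally have lhs: "emeasure ?Q3 (A \<times> D) = ?I" .
    have "emeasure (density R (\<lambda>x. \<phi> (snd x))) (A \<times> D)
        = (\<integral>\<^sup>+x. ennreal (\<phi> (snd x)) * indicator (A \<times> D) x \<partial>R)"
      by (rule emeasure_density) measurable
    also have "\<dots> = (\<integral>\<^sup>+x. ennreal (\<phi> (fst x, snd (snd x)))
          * indicator (A \<times> D) (fst (snd x), fst x, snd (snd x)) \<partial>(PV \<Otimes>\<^sub>M PUW))"
      unfolding R_def by (subst nn_integral_distr) (auto simp: split_beta')
    also have "\<dots> = (\<integral>\<^sup>+v. \<integral>\<^sup>+x. ennreal (\<phi> (v, snd x)) * indicator (A \<times> D) (fst x, v, snd x) \<partial>PUW \<partial>PV)"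
      by (subst PUW.nn_integral_fst[symmetric]) auto
    \<comment> \<open>For fixed \<open>v\<close> the integrand depends on \<open>U\<close> only
      through the indicator of \<open>A\<close>, so conditioning on \<open>W\<close> replaces that
      indicator by the kernel.\<close>
    also have "\<dots> = (\<integral>\<^sup>+v. \<integral>\<^sup>+w. emeasure (K w) A * (ennreal (\<phi> (v, w)) * indicator D (v, w)) \<partial>PW \<partial>PV)"
    proof (rule nn_integral_cong)
      fix v assume "v \<in> space PV"
      then have [measurable]: "v \<in> space MV" by (simp add: PV_def)
      have "(\<integral>\<^sup>+x. ennreal (\<phi> (v, snd x)) * indicator (A \<times> D) (fst x, v, snd x) \<partial>PUW)
          = (\<integral>\<^sup>+\<omega>. indicator A (U \<omega>) * (ennreal (\<phi> (v, W \<omega>)) * indicator D (v, W \<omega>)) \<partial>M)"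
        unfolding PUW_def
        by (subst nn_integral_distr) (auto intro!: nn_integral_cong split: split_indicator)
      also have "\<dots> = (\<integral>\<^sup>+w. emeasure (K w) A * (ennreal (\<phi> (v, w)) * indicator D (v, w)) \<partial>PW)"
        unfolding PW_def by (rule nn_integral_regular_cond_distr[OF M U W K A]) measurable
      finally show "(\<integral>\<^sup>+x. ennreal (\<phi> (v, snd x)) * indicator (A \<times> D) (fst x, v, snd x) \<partial>PUW)
        = (\<integral>\<^sup>+w. emeasure (K w) A * (ennreal (\<phi> (v, w)) * indicator D (v, w)) \<partial>PW)" .
    qed
    also have "\<dots> = (\<integral>\<^sup>+x. ennreal (\<phi> x) * (emeasure (K (snd x)) A * indicator D x) \<partial>(PV \<Otimes>\<^sub>M PW))"
      by (subst PW.nn_integral_fst[symmetric]) (auto simp: ac_simps)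
    also have "\<dots> = (\<integral>\<^sup>+x. emeasure (K (snd x)) A * indicator D x \<partial>PVW)"
      unfolding PVW by (subst nn_integral_density) auto
    also have "\<dots> = ?I"
      unfolding PVW_def by (subst nn_integral_distr) auto
    finally show "emeasure ?Q3 (A \<times> D) = emeasure (density R (\<lambda>x. \<phi> (snd x))) (A \<times> D)"
      using lhs by simp
  qed (simp_all add: R_def)
  have Q3p: "prob_space (density R (\<lambda>x. \<phi> (snd x)))"
    unfolding Q3[symmetric] by (rule Q1N.prob_space_distr) measurable
  have PVW_P3: "PVW = distr P3 (MV \<Otimes>\<^sub>M MW) snd"
    unfolding P3_def PVW_def by (subst distr_distr) (auto simp: comp_def)
  have iP3: "integrable P3 (\<lambda>x. log b (\<phi> (snd x)))"
    and I\<phi>: "(\<integral>x. log b (\<phi> x) \<partial>PVW) = (\<integral>x. log b (\<phi> (snd x)) \<partial>P3)"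
    using i\<phi> unfolding PVW_P3 by (simp_all add: integrable_distr_eq integral_distr)
  \<comment> \<open>Forgetting \<open>w\<close> turns \<open>R\<close> into the reference measure of
    the mutual information of \<open>U\<close> and \<open>V\<close>.\<close>
  have UV: "distr R (MU \<Otimes>\<^sub>M MV) (\<lambda>(u, v, w). (u, v)) = distr M MU U \<Otimes>\<^sub>M distr M MV V" (is "?RUV = _")
  proof (rule finite_measure_eqI_Times)
    show "finite_measure ?RUV"
      by (intro prob_space.finite_measure R.prob_space_distr) measurable
    fix A B assume A [measurable]: "A \<in> sets MU" and B [measurable]: "B \<in> sets MV"
    have "?RUV = distr (PV \<Otimes>\<^sub>M PUW) (MU \<Otimes>\<^sub>M MV) (\<lambda>(v, u, w). (u, v))"
      unfolding R_def by (subst distr_distr) (auto simp: comp_def split_beta')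
    moreover have "(\<lambda>(v, u, w). (u, v)) -` (A \<times> B) \<inter> space (PV \<Otimes>\<^sub>M PUW) = B \<times> (A \<times> space MW)"
      using sets.sets_into_space[OF A] sets.sets_into_space[OF B]
      by (auto simp: space_pair_measure PV_def PUW_def)
    ultimately have "emeasure ?RUV (A \<times> B) = emeasure PV B * emeasure PUW (A \<times> space MW)"
      by (simp add: emeasure_distr PUW.emeasure_pair_measure_Times)
    also have "emeasure PUW (A \<times> space MW) = emeasure (distr M MU U) A"
      unfolding PUW_def using measurable_space[OF W]
      by (auto simp: emeasure_distr intro!: arg_cong[where f="emeasure M"])
    finally show "emeasure ?RUV (A \<times> B) = emeasure (distr M MU U \<Otimes>\<^sub>M distr M MV V) (A \<times> B)"
      using PV.emeasure_pair_measure_Times[of A "distr M MU U" B] by (simp add: PV_def ac_simps)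
  qed (simp_all cong: sets_pair_measure_cong)
  \<comment> \<open>The chain of estimates: restore \<open>w\<close> by data processing, pass from
    \<open>R\<close> to its reweighting by \<open>\<phi>\<close> at the price of the term for
    \<open>V\<close> and \<open>W\<close>, undo \<open>T\<close> by data processing, and drop the
    noise.\<close>
  have "ext_mutual_information b M MU MV U V
      = ext_KL_divergence b ?RUV (distr P3 (MU \<Otimes>\<^sub>M MV) (\<lambda>(u, v, w). (u, v)))"
    unfolding ext_mutual_information_def UV P3_def by (subst distr_distr) (auto simp: comp_def)
  also have "\<dots> \<le> ext_KL_divergence b R P3"
    by (rule ext_KL_divergence_distr_le[OF b R.prob_space_axioms P3.prob_space_axioms])
      (simp_all add: P3_def R_def)
  also have "\<dots> \<le> ext_KL_divergence b (density R (\<lambda>x. \<phi> (snd x))) P3 + ennreal (\<integral>x. log b (\<phi> (snd x)) \<partial>P3)"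
    by (rule ext_KL_divergence_trans_le[OF b R.prob_space_axioms _ _ Q3p P3.prob_space_axioms _ iP3])
      (simp_all add: \<phi>0 P3_def R_def)
  also have "ext_KL_divergence b (density R (\<lambda>x. \<phi> (snd x))) P3 \<le> ext_KL_divergence b (Q1 \<Otimes>\<^sub>M N) (P1 \<Otimes>\<^sub>M N)"
    unfolding Q3[symmetric] P3
    by (rule ext_KL_divergence_distr_le[OF b Q1N.prob_space_axioms P1N.prob_space_axioms])
      (simp_all add: sQ1 P1_def cong: sets_pair_measure_cong)
  also have "\<dots> \<le> ext_KL_divergence b Q1 P1"
    by (rule ext_KL_divergence_pair_le[OF Q1.prob_space_axioms P1.prob_space_axioms _ N.prob_space_axioms])
      (simp add: sQ1 P1_def)
  also have "ext_KL_divergence b Q1 P1 = ext_cond_mutual_information b M MU MW' MW U W' W"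
    unfolding Q1_def P1_def by (rule ext_cond_mutual_information_eq[OF M W K L, symmetric])
  also have "ennreal (\<integral>x. log b (\<phi> (snd x)) \<partial>P3) = ext_mutual_information b M MV MW V W"
    using KL\<phi> I\<phi> by (simp add: ext_mutual_information_def PV_def PW_def PVW_def)
  finally show ?thesis
    by (simp add: add.commute add_right_mono)
qed

section \<open>Independence of the noise and the two inequalities\<close>

text \<open>Every event of \<open>T\<close> lies in the sigma-algebra generated by \<open>X\<close>,
  so the product formula holds on rectangles. Stating this through preimages avoids factoring
  \<open>T\<close> through \<open>X\<close>.\<close>

lemma distr_indep_rv:
  assumes M: "prob_space M" and ind: "indep_rv M ME e MX X" and Tm: "T \<in> M \<rightarrow>\<^sub>M MT"
    and T: "\<And>B. B \<in> sets MT \<Longrightarrow> T -` B \<inter> space M \<in> sets (vimage_algebra (space M) X MX)"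
  shows "distr M (MT \<Otimes>\<^sub>M ME) (\<lambda>\<omega>. (T \<omega>, e \<omega>)) = distr M MT T \<Otimes>\<^sub>M distr M ME e"
proof -
  interpret prob_space M by fact
  note [measurable] = Tm
  have e [measurable]: "e \<in> M \<rightarrow>\<^sub>M ME" and X: "X \<in> M \<rightarrow>\<^sub>M MX"
    and iset: "indep_set (sigma_sets (space M) {e -` A \<inter> space M |A. A \<in> sets ME})
       (sigma_sets (space M) {X -` B \<inter> space M |B. B \<in> sets MX})"
    using ind by (auto simp: indep_rv_def)
  interpret e: prob_space "distr M ME e" by (rule prob_space_distr) measurable
  show ?thesis
  proof (rule finite_measure_eqI_Times)
    show "finite_measure (distr M (MT \<Otimes>\<^sub>M ME) (\<lambda>\<omega>. (T \<omega>, e \<omega>)))"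
      by (intro prob_space.finite_measure prob_space_distr) measurable
    fix A B assume A [measurable]: "A \<in> sets MT" and B [measurable]: "B \<in> sets ME"
    have "T -` A \<inter> space M \<in> sigma_sets (space M) {X -` B \<inter> space M |B. B \<in> sets MX}"
      using T[OF A] by (simp add: sets_vimage_algebra)
    moreover have "e -` B \<inter> space M \<in> sigma_sets (space M) {e -` A \<inter> space M |A. A \<in> sets ME}"
      using B by (intro sigma_sets.Basic) blast
    ultimately have "prob ((e -` B \<inter> space M) \<inter> (T -` A \<inter> space M))
        = prob (e -` B \<inter> space M) * prob (T -` A \<inter> space M)"
      using iset by (auto dest: indep_setD)
    moreover have "(\<lambda>\<omega>. (T \<omega>, e \<omega>)) -` (A \<times> B) \<inter> space M = (e -` B \<inter> space M) \<inter> (T -` A \<inter> space M)"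
      by auto
    ultimately show "emeasure (distr M (MT \<Otimes>\<^sub>M ME) (\<lambda>\<omega>. (T \<omega>, e \<omega>))) (A \<times> B)
        = emeasure (distr M MT T \<Otimes>\<^sub>M distr M ME e) (A \<times> B)"
      by (simp add: emeasure_distr e.emeasure_pair_measure_Times emeasure_eq_measure ennreal_mult'[symmetric] mult.commute)
  qed (simp_all cong: sets_pair_measure_cong)
qed

theorem proposition1:
  fixes M :: "'a measure"
    and SS :: "(real ^ 'ds) set" and CC :: "(real ^ 'dc) set" and XM :: "'x measure"
    and S :: "'a \<Rightarrow> real ^ 'ds" and C :: "'a \<Rightarrow> real ^ 'dc" and Y :: "'a \<Rightarrow> nat"
    and eps :: "'a \<Rightarrow> real ^ 'k"
    and X Xhat :: "'a \<Rightarrow> 'x"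
    and g :: "(real ^ 'ds) \<times> (real ^ 'dc) \<Rightarrow> 'x"
    and f :: "'x \<Rightarrow> real ^ 'd"
    and phiS :: "real ^ 'ds \<Rightarrow> real ^ 'd" and phiC :: "real ^ 'dc \<Rightarrow> real ^ 'd"
    and VS VC :: "(real ^ 'd) set"
    and Z ZS ZC ZhatS ZhatC :: "'a \<Rightarrow> real ^ 'd"
    and G :: "(real ^ 'd) \<times> (real ^ 'k) \<Rightarrow> 'x"
    and E :: "real ^ 'd \<Rightarrow> (real ^ 'd) \<times> (real ^ 'd)"
    and Shat :: "'a \<Rightarrow> real ^ 'ds" and Chat :: "'a \<Rightarrow> real ^ 'dc"
    and b :: real
  assumes prob: "prob_space M" and base: "1 < b"
    \<comment> \<open>real factors, label and images\<close>
    and zero_SS: "0 \<in> SS"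
    and S_rv: "S \<in> M \<rightarrow>\<^sub>M restrict_space borel SS"
    and C_rv: "C \<in> M \<rightarrow>\<^sub>M restrict_space borel CC"
    and S_C_indep: "indep_rv M borel S borel C"
    and Y_rv: "Y \<in> M \<rightarrow>\<^sub>M count_space {0, 1}"
    and Y_iff: "\<And>\<omega>. \<omega> \<in> space M \<Longrightarrow> Y \<omega> = 0 \<longleftrightarrow> S \<omega> = 0"
    and Y_pos: "measure M {\<omega> \<in> space M. Y \<omega> = 0} > 0"
    and g_bij: "bij_betw g (SS \<times> CC) (space XM)"
    and g_meas: "g \<in> restrict_space borel SS \<Otimes>\<^sub>M restrict_space borel CC \<rightarrow>\<^sub>M XM"
    and g_inv_meas: "the_inv_into (SS \<times> CC) g
          \<in> XM \<rightarrow>\<^sub>M restrict_space borel SS \<Otimes>\<^sub>M restrict_space borel CC"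
    and X_def: "X = (\<lambda>\<omega>. g (S \<omega>, C \<omega>))"
    \<comment> \<open>conditioning\<close>
    and VS: "subspace VS" and VC: "subspace VC"
    and V_direct: "VS \<inter> VC = {0}" and V_sum: "{u + v | u v. u \<in> VS \<and> v \<in> VC} = UNIV"
    and phiS_meas: "phiS \<in> restrict_space borel SS \<rightarrow>\<^sub>M restrict_space borel VS"
    and phiC_meas: "phiC \<in> restrict_space borel CC \<rightarrow>\<^sub>M restrict_space borel VC"
    and phiS_0: "phiS 0 = 0"
    and Z_def: "Z = (\<lambda>\<omega>. f (X \<omega>))"
    and ZS_def: "ZS = (\<lambda>\<omega>. phiS (S \<omega>))" and ZC_def: "ZC = (\<lambda>\<omega>. phiC (C \<omega>))"
    and Z_additive: "\<And>\<omega>. \<omega> \<in> space M \<Longrightarrow> Z \<omega> = ZS \<omega> + ZC \<omega>"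
    \<comment> \<open>generator\<close>
    and eps_normal: "distributed M lborel eps (\<lambda>x. ennreal (\<Prod>i\<in>UNIV. std_normal_density (x $ i)))"
    and eps_indep: "indep_rv M borel eps
          (borel \<Otimes>\<^sub>M borel \<Otimes>\<^sub>M count_space {0, 1}) (\<lambda>\<omega>. (S \<omega>, C \<omega>, Y \<omega>))"
    and G_meas: "G \<in> borel \<Otimes>\<^sub>M borel \<rightarrow>\<^sub>M XM"
    and Xhat_def: "Xhat = (\<lambda>\<omega>. G (Z \<omega>, eps \<omega>))"
    and Shat_def: "Shat = (\<lambda>\<omega>. fst (the_inv_into (SS \<times> CC) g (Xhat \<omega>)))"
    and Chat_def: "Chat = (\<lambda>\<omega>. snd (the_inv_into (SS \<times> CC) g (Xhat \<omega>)))"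
    \<comment> \<open>decomposition of the conditioning\<close>
    and E_meas: "E \<in> borel \<rightarrow>\<^sub>M borel \<Otimes>\<^sub>M borel"
    and ZhatS_def: "ZhatS = (\<lambda>\<omega>. fst (E (Z \<omega>)))" and ZhatC_def: "ZhatC = (\<lambda>\<omega>. snd (E (Z \<omega>)))"
    and Zhat_sum: "AE \<omega> in M. ZhatS \<omega> + ZhatC \<omega> = Z \<omega>"
    and Zhat_label: "AE \<omega> in M. Y \<omega> = 0 \<longleftrightarrow> ZhatS \<omega> = 0"
    and Zhat_indep: "prob_space.indep_var M borel ZhatS borel ZhatC"
  shows "(ext_mutual_information b M borel borel S Shat
           \<le> ext_mutual_information b M borel borel Shat ZhatS
             + ext_cond_mutual_information b M XM borel borel Xhat eps Z
             + ext_cond_mutual_information b M borel borel borel S ZhatC ZhatS)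
       \<and> (ext_mutual_information b M borel borel C Chat
           \<le> ext_mutual_information b M borel borel Chat ZhatC
             + ext_cond_mutual_information b M XM borel borel Xhat eps Z
             + ext_cond_mutual_information b M borel borel borel C ZhatS ZhatC)"
proof
  interpret prob_space M by fact
  let ?BSS = "restrict_space borel SS :: (real ^ 'ds) measure"
  let ?BCC = "restrict_space borel CC :: (real ^ 'dc) measure"
  let ?SCY = "\<lambda>\<omega>. (S \<omega>, C \<omega>, Y \<omega>)"
  let ?MSCY = "(borel :: (real ^ 'ds) measure) \<Otimes>\<^sub>M (borel :: (real ^ 'dc) measure) \<Otimes>\<^sub>M count_space {0, 1 :: nat}"
  \<comment> \<open>The sigma-algebra generated by \<open>(S, C, Y)\<close>, from which
    \<open>eps\<close> is independent. Measurability is proved relative to \<open>?F\<close> so that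
    independence from \<open>eps\<close> follows as well.\<close>
  let ?F = "vimage_algebra (space M) ?SCY ?MSCY"
  have incl: "id \<in> restrict_space borel A \<rightarrow>\<^sub>M borel" for A :: "'z::topological_space set"
    by (simp add: measurable_restrict_space1)
  have S_in: "S \<omega> \<in> SS" and C_in: "C \<omega> \<in> CC" if "\<omega> \<in> space M" for \<omega>
    using measurable_space[OF S_rv that] measurable_space[OF C_rv that] by (auto simp: space_restrict_space)
  have S [measurable]: "S \<in> M \<rightarrow>\<^sub>M borel" and C [measurable]: "C \<in> M \<rightarrow>\<^sub>M borel"
    using measurable_comp[OF S_rv incl] measurable_comp[OF C_rv incl] by simp_all
  note [measurable] = Y_rv E_meas G_meas
  have SCY: "?SCY \<in> M \<rightarrow>\<^sub>M ?MSCY" by measurable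
  have F: "?SCY \<in> ?F \<rightarrow>\<^sub>M ?MSCY"
    using measurable_space[OF SCY] by (intro measurable_vimage_algebra1) auto
  have S_F: "S \<in> ?F \<rightarrow>\<^sub>M borel" and C_F: "C \<in> ?F \<rightarrow>\<^sub>M borel"
    using measurable_compose[OF F measurable_fst] measurable_compose[OF measurable_compose[OF F measurable_snd] measurable_fst]
    by simp_all
  have "S \<in> ?F \<rightarrow>\<^sub>M ?BSS" "C \<in> ?F \<rightarrow>\<^sub>M ?BCC"
    using S_F C_F S_in C_in by (auto intro!: measurable_restrict_space2)
  then have "ZS \<in> ?F \<rightarrow>\<^sub>M borel" "ZC \<in> ?F \<rightarrow>\<^sub>M borel"
    using measurable_comp[OF measurable_comp[OF _ phiS_meas] incl]
      measurable_comp[OF measurable_comp[OF _ phiC_meas] incl]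
    by (simp_all add: ZS_def ZC_def comp_def)
  then have "(\<lambda>\<omega>. ZS \<omega> + ZC \<omega>) \<in> ?F \<rightarrow>\<^sub>M borel" by measurable
  \<comment> \<open>The additive structure yields this: \<open>phiS\<close> and \<open>phiC\<close>
    are measurable, and \<open>Z\<close> agrees with \<open>ZS + ZC\<close> on the space.\<close>
  then have Z_F [measurable]: "Z \<in> ?F \<rightarrow>\<^sub>M borel"
    using Z_additive by (subst measurable_cong[where g="\<lambda>\<omega>. ZS \<omega> + ZC \<omega>"]) auto
  have ZhatS_F: "ZhatS \<in> ?F \<rightarrow>\<^sub>M borel" and ZhatC_F: "ZhatC \<in> ?F \<rightarrow>\<^sub>M borel"
    unfolding ZhatS_def ZhatC_def by measurable
  have F_M: "T \<in> M \<rightarrow>\<^sub>M MT" if "T \<in> ?F \<rightarrow>\<^sub>M MT" for T and MT :: "'t measure"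
  proof (rule measurableI)
    show "T \<omega> \<in> space MT" if "\<omega> \<in> space M" for \<omega>
      using measurable_space[OF \<open>T \<in> ?F \<rightarrow>\<^sub>M MT\<close>] that by simp
    show "T -` B \<inter> space M \<in> sets M" if "B \<in> sets MT" for B
      using measurable_sets[OF \<open>T \<in> ?F \<rightarrow>\<^sub>M MT\<close> that] sets_vimage_algebra_space
        sets_image_in_sets[OF _ SCY] by auto
  qed
  have indep: "distr M (MT \<Otimes>\<^sub>M borel) (\<lambda>\<omega>. (T \<omega>, eps \<omega>)) = distr M MT T \<Otimes>\<^sub>M distr M borel eps"
    if "T \<in> ?F \<rightarrow>\<^sub>M MT" for T and MT :: "'t measure"
    using measurable_sets[OF that] by (intro distr_indep_rv[OF prob eps_indep F_M[OF that]]) simp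
  have [measurable]: "Z \<in> M \<rightarrow>\<^sub>M borel" "ZhatS \<in> M \<rightarrow>\<^sub>M borel" "ZhatC \<in> M \<rightarrow>\<^sub>M borel"
    by (intro F_M Z_F ZhatS_F ZhatC_F)+
  have eps [measurable]: "eps \<in> M \<rightarrow>\<^sub>M borel" using eps_indep by (simp add: indep_rv_def)
  define gS where "gS = (\<lambda>z. fst (the_inv_into (SS \<times> CC) g (G z)))"
  define gC where "gC = (\<lambda>z. snd (the_inv_into (SS \<times> CC) g (G z)))"
  note ginv = measurable_compose[OF G_meas g_inv_meas]
  have [measurable]: "gS \<in> borel \<Otimes>\<^sub>M borel \<rightarrow>\<^sub>M borel" "gC \<in> borel \<Otimes>\<^sub>M borel \<rightarrow>\<^sub>M borel"
    using measurable_comp[OF measurable_compose[OF ginv measurable_fst] incl]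
      measurable_comp[OF measurable_compose[OF ginv measurable_snd] incl]
    by (simp_all add: comp_def gS_def gC_def)
  have Shat: "Shat = (\<lambda>\<omega>. gS (Z \<omega>, eps \<omega>))" and Chat: "Chat = (\<lambda>\<omega>. gC (Z \<omega>, eps \<omega>))"
    by (simp_all add: Shat_def Chat_def Xhat_def gS_def gC_def)
  have [measurable]: "Shat \<in> M \<rightarrow>\<^sub>M borel" "Chat \<in> M \<rightarrow>\<^sub>M borel"
    unfolding Shat Chat by measurable
  \<comment> \<open>In \<open>h\<close> the first pair is \<open>(ZhatC, ZhatS)\<close>; adding its
    entries recovers \<open>Z\<close> almost surely, and \<open>gS\<close> then regenerates
    \<open>Shat\<close> from \<open>Z\<close> and the noise.\<close>
  have "ext_mutual_information b M borel borel S Shat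
      \<le> ext_mutual_information b M borel borel Shat ZhatS
        + ext_cond_mutual_information b M borel borel borel S ZhatC ZhatS"
    by (rule ext_mutual_information_le_chain[OF base prob, where e=eps and ME=borel
          and h="\<lambda>x. gS (snd (fst x) + fst (fst x), snd x)"])
       (use Zhat_sum in \<open>auto simp: Shat intro!: indep measurable_Pair S_F ZhatS_F ZhatC_F elim: AE_mp\<close>)
  then show "ext_mutual_information b M borel borel S Shat
      \<le> ext_mutual_information b M borel borel Shat ZhatS
        + ext_cond_mutual_information b M XM borel borel Xhat eps Z
        + ext_cond_mutual_information b M borel borel borel S ZhatC ZhatS"
    by (rule order_trans) (intro add_right_mono add_increasing2, simp_all)
  \<comment> \<open>The pair is now \<open>(ZhatS, ZhatC)\<close>, so the summands of
    \<open>h\<close> are taken in the other order to match \<open>Zhat_sum\<close>.\<close>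
  have "ext_mutual_information b M borel borel C Chat
      \<le> ext_mutual_information b M borel borel Chat ZhatC
        + ext_cond_mutual_information b M borel borel borel C ZhatS ZhatC"
    by (rule ext_mutual_information_le_chain[OF base prob, where e=eps and ME=borel
          and h="\<lambda>x. gC (fst (fst x) + snd (fst x), snd x)"])
       (use Zhat_sum in \<open>auto simp: Chat intro!: indep measurable_Pair C_F ZhatS_F ZhatC_F elim: AE_mp\<close>)
  then show "ext_mutual_information b M borel borel C Chat
      \<le> ext_mutual_information b M borel borel Chat ZhatC
        + ext_cond_mutual_information b M XM borel borel Xhat eps Z
        + ext_cond_mutual_information b M borel borel borel C ZhatS ZhatC"
    by (rule order_trans) (intro add_right_mono add_increasing2, simp_all)
qed

end
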